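(* Let $\omega_1$ be the first uncountable ordinal. Let $A'$ be the set of all injective maps $\omega\to\omega\times\omega_1$, let $A''=2^\omega$ (the set of subsets of $\omega$, identified with functions $\omega\to\{0,1\}$), and let $A=A'\times A''$. Let $\{u_n\mid n\in\omega\}$ be any countable $T_1$ family of subsets of $A$ (such a family exists since $A$ has continuum cardinality), regarded as functions $A\to\{0,1\}$. For each $(n,\gamma)\in\omega\times\omega_1$ define $w_{n,\gamma}:A\to\{0,1\}$ by $w_{n,\gamma}(a',a'')=u_n(a',a'')$ if $(n,\gamma)$ is not among the values $a'(i)$ $(i\in\omega)$, and $w_{n,\gamma}(a',a'')=a''(i)$ if $i\in\omega$ satisfies $a'(i)=(n,\gamma)$. Let $W$ be the closure of $\{w_{n,\gamma}\mid n\in\omega,\gamma\in\omega_1\}\cup\{\emptyset,A\}$ under pairwise unions and intersections. Then $(A,W)$ is a non-discrete $T_1$ Pratt comonoid, with $\mathrm{card}(A)=2^{\aleph_0}$ and $\mathrm{card}(W)=\aleph_1$.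
   Context: A Pratt comonoid is a pair $(A,W)$ where $A$ is a set and $W$ is a set of subsets of $A$ such that (i) $\emptyset\in W$ and $A\in W$; (ii) whenever $C\subseteq A\times A$ is such that for every $a\in A$ both the $a$-th row $\{b\mid (a,b)\in C\}$ and the $a$-th column $\{b\mid (b,a)\in C\}$ belong to $W$ (a crossword over $W$), the diagonal $\{b\mid (b,b)\in C\}$ also belongs to $W$. A family $W$ of subsets of $A$ is $T_1$ if for all distinct $a,b\in A$ some member of $W$ contains $a$ but not $b$. $(A,W)$ is discrete if $W$ is the full power set of $A$. Subsets are identified with their $\{0,1\}$-valued characteristic functions. *)

theory Defs
  imports Main
begin

definition pratt_comonoid :: "'a set \<Rightarrow> 'a set set \<Rightarrow> bool" where
  "pratt_comonoid A W \<longleftrightarrow>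
     W \<subseteq> Pow A \<and> {} \<in> W \<and> A \<in> W \<and>
     (\<forall>C. C \<subseteq> A \<times> A \<longrightarrow>
        (\<forall>a\<in>A. {b. (a, b) \<in> C} \<in> W \<and> {b. (b, a) \<in> C} \<in> W) \<longrightarrow>
        {b. (b, b) \<in> C} \<in> W)"

definition T1_family :: "'a set \<Rightarrow> 'a set set \<Rightarrow> bool" where
  "T1_family A W \<longleftrightarrow> (\<forall>a\<in>A. \<forall>b\<in>A. a \<noteq> b \<longrightarrow> (\<exists>S\<in>W. a \<in> S \<and> b \<notin> S))"

definition discrete :: "'a set \<Rightarrow> 'a set set \<Rightarrow> bool" where
  "discrete A W \<longleftrightarrow> W = Pow A"

inductive_set union_inter_closure :: "'a set set \<Rightarrow> 'a set set" for G where
  base: "S \<in> G \<Longrightarrow> S \<in> union_inter_closure G"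
| un: "S \<in> union_inter_closure G \<Longrightarrow> T \<in> union_inter_closure G \<Longrightarrow> S \<union> T \<in> union_inter_closure G"
| int: "S \<in> union_inter_closure G \<Longrightarrow> T \<in> union_inter_closure G \<Longrightarrow> S \<inter> T \<in> union_inter_closure G"

text \<open>The first uncountable ordinal, as the field of the canonical successor cardinal of
  aleph_0 (the well-order natLeq on nat).\<close>
definition omega1 :: "nat set set" where
  "omega1 = Field (cardSuc natLeq)"

text \<open>A' = injective maps omega -> omega x omega_1; A'' = subsets of omega (a''(i)=1 iff i in a'').\<close>
definition A' :: "(nat \<Rightarrow> nat \<times> nat set) set" where
  "A' = {f. inj f \<and> range f \<subseteq> UNIV \<times> omega1}"

definition A'' :: "nat set set" where
  "A'' = UNIV"

definition A :: "((nat \<Rightarrow> nat \<times> nat set) \<times> nat set) set" where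
  "A = A' \<times> A''"

definition w :: "(nat \<Rightarrow> ((nat \<Rightarrow> nat \<times> nat set) \<times> nat set) set) \<Rightarrow> nat \<Rightarrow> nat set
                  \<Rightarrow> ((nat \<Rightarrow> nat \<times> nat set) \<times> nat set) set" where
  "w u n \<gamma> = {(a', a''). (a', a'') \<in> A \<and>
      (if (n, \<gamma>) \<notin> range a' then (a', a'') \<in> u n
       else (\<exists>i. a' i = (n, \<gamma>) \<and> i \<in> a''))}"

definition W :: "(nat \<Rightarrow> ((nat \<Rightarrow> nat \<times> nat set) \<times> nat set) set)
                  \<Rightarrow> ((nat \<Rightarrow> nat \<times> nat set) \<times> nat set) set set" where
  "W u = union_inter_closure ({w u n \<gamma> | n \<gamma>. \<gamma> \<in> omega1} \<union> {{}, A})"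

end

theory Submission
  imports Defs "HOL-Library.Countable_Set" "HOL-Library.Diagonal_Subsequence" "HOL-Library.Nat_Bijection"
begin

text \<open>
  Write \<open>om a\<close> for the set of indices \<open>x\<close> with \<open>a \<in> w\<^sub>x\<close>. Any countable pattern of indices is
  realised by some \<open>om a\<close>, and \<open>W\<close> consists of the sets of points on which membership depends
  monotonically on finitely many coordinates of \<open>om a\<close>. A crossword \<open>C\<close> has all its rows and columns
  of this kind; its diagonal is in \<open>W\<close> once \<open>C\<close> itself depends jointly on finitely many coordinates.

  Evaluate the columns of \<open>C\<close> at an arbitrary set \<open>M\<close> of indices. The resulting limit row still
  depends on finitely many coordinates: otherwise there are points \<open>a\<^sub>k\<close> converging to \<open>M\<close> on a
  countable set whose rows involve disjoint nonempty sets \<open>P\<^sub>k\<close> of coordinates, and some point \<open>b\<close>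
  makes \<open>C(a\<^sub>k, b)\<close> alternate; but outside a countable set the coordinates of \<open>a\<^sub>k\<close> are the values
  \<open>u\<^sub>n(a\<^sub>k)\<close>, so a diagonal subsequence makes all coordinates, hence the column of \<open>b\<close>, converge.

  Taking \<open>M\<close> finite or cofinite, monotonicity shows that \<open>C\<close> is jointly open and closed, and
  compactness of a countable power of \<open>{0,1}\<close> gives a joint finite support.
\<close>

section \<open>Pointwise convergent sequences of sets\<close>

text \<open>Sequential compactness of the power set of a countable set: a diagonal sequence settles
  one element of \<open>Y\<close> after another.\<close>

lemma pointwise_convergent_subsequence:
  fixes S :: "nat \<Rightarrow> 'x set"
  assumes "countable Y"
  shows "\<exists>(r :: nat \<Rightarrow> nat) L. strict_mono r \<and>
    (\<forall>y\<in>Y. \<exists>k0. \<forall>k\<ge>k0. y \<in> S (r k) \<longleftrightarrow> y \<in> L)"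
proof -
  define y where "y = from_nat_into Y"
  define stable where
    "stable n s \<longleftrightarrow> (\<exists>c. \<exists>k0. \<forall>k\<ge>k0. (y n \<in> S (s k)) = c)" for n and s :: "nat \<Rightarrow> nat"
  have ex: "\<exists>r'. strict_mono r' \<and> stable n (s \<circ> r')" for n and s :: "nat \<Rightarrow> nat"
  proof -
    obtain c where c: "infinite {k. (y n \<in> S (s k)) = c}"
    proof (cases "infinite {k. (y n \<in> S (s k)) = True}")
      case False
      have "{k. (y n \<in> S (s k)) = False} = - {k. (y n \<in> S (s k)) = True}" by auto
      with False have "infinite {k. (y n \<in> S (s k)) = False}"
        by (metis finite_compl infinite_UNIV_nat)
      then show ?thesis using that by blast
    qed (use that in blast)
    then obtain r' :: "nat \<Rightarrow> nat" where "strict_mono r'" "\<And>k. r' k \<in> {k. (y n \<in> S (s k)) = c}"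
      using infinite_enumerate by blast
    then show ?thesis by (auto simp: stable_def)
  qed
  interpret subseqs stable
    by unfold_locales (rule ex)
  have "stable n diagseq" for n
  proof -
    \<comment> \<open>The diagonal sequence refines the \<open>n\<close>-th subsequence only from
      position \<open>Suc n\<close> on; the shift is removed afterwards.\<close>
    have "stable n (diagseq \<circ> (+) (Suc n))"
    proof (rule diagseq_holds)
      fix n and r s :: "nat \<Rightarrow> nat"
      assume "strict_mono r" "stable n s"
      then obtain c k0 where "\<forall>k\<ge>k0. (y n \<in> S (s k)) = c" by (auto simp: stable_def)
      then have "\<forall>k\<ge>k0. (y n \<in> S ((s \<circ> r) k)) = c"
        using seq_suble[OF \<open>strict_mono r\<close>] order_trans by (metis comp_apply)
      then show "stable n (s \<circ> r)" unfolding stable_def by blast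
    qed
    then obtain c k0 where c: "\<And>k. k \<ge> k0 \<Longrightarrow> (y n \<in> S (diagseq (Suc n + k))) = c"
      unfolding stable_def comp_def by blast
    have "(y n \<in> S (diagseq k)) = c" if "k \<ge> Suc n + k0" for k
      using c[of "k - Suc n"] that by simp
    then show ?thesis unfolding stable_def by blast
  qed
  then have st: "\<exists>c. \<exists>k0. \<forall>k\<ge>k0. (z \<in> S (diagseq k)) = c" if "z \<in> Y" for z
    using from_nat_into_surj[OF assms that] by (auto simp: stable_def y_def)
  define L where "L = {z. \<exists>k0. \<forall>k\<ge>k0. z \<in> S (diagseq k)}"
  have "\<exists>k0. \<forall>k\<ge>k0. z \<in> S (diagseq k) \<longleftrightarrow> z \<in> L" if z: "z \<in> Y" for z
  proof -
    obtain c k0 where k0: "\<forall>k\<ge>k0. (z \<in> S (diagseq k)) = c" using st[OF z] by blast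
    have "z \<in> L \<longleftrightarrow> c"
    proof
      assume "z \<in> L"
      then obtain k1 where "\<forall>k\<ge>k1. z \<in> S (diagseq k)" by (auto simp: L_def)
      then have "z \<in> S (diagseq (max k0 k1))" by simp
      with k0 show c by simp
    next
      assume c with k0 show "z \<in> L" by (auto simp: L_def)
    qed
    with k0 show ?thesis by blast
  qed
  with subseq_diagseq show ?thesis by blast
qed

lemma eventually_inter_finite_eq:
  fixes S :: "nat \<Rightarrow> 'x set"
  assumes "finite F" "\<And>y. y \<in> F \<Longrightarrow> \<exists>k0. \<forall>k\<ge>k0. y \<in> S k \<longleftrightarrow> y \<in> L"
  shows "\<exists>k0. \<forall>k\<ge>k0. S k \<inter> F = L \<inter> F"
  using assms
proof (induction F)
  case (insert x F)
  obtain k0 where k0: "\<forall>k\<ge>k0. S k \<inter> F = L \<inter> F" using insert by auto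
  obtain k1 where k1: "\<forall>k\<ge>k1. x \<in> S k \<longleftrightarrow> x \<in> L" using insert.prems[of x] by blast
  have "\<forall>k\<ge>max k0 k1. S k \<inter> insert x F = L \<inter> insert x F"
    using k0 k1 by (simp add: Int_insert_right)
  then show ?case by blast
qed simp

section \<open>Countably independent codes and finite supports\<close>

text \<open>Abstracts the coding of points: \<open>om a\<close> collects the indices whose generator
  contains \<open>a\<close>, \<open>rng a\<close> those that \<open>a\<close> treats individually,
  and \<open>col x\<close> numbers the set \<open>u\<close> that decides every other index.\<close>

locale countably_independent =
  fixes E :: "'a set" and I :: "'x set" and om :: "'a \<Rightarrow> 'x set"
    and rng :: "'a \<Rightarrow> 'x set" and col :: "'x \<Rightarrow> nat" and u :: "nat \<Rightarrow> 'a set"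
  assumes indep: "\<lbrakk>countable Y; Y \<subseteq> I; Z \<subseteq> Y\<rbrakk> \<Longrightarrow> \<exists>a\<in>E. om a \<inter> Y = Z"
    and countable_rng: "a \<in> E \<Longrightarrow> countable (rng a)"
    and generic: "\<lbrakk>a \<in> E; x \<in> I; x \<notin> rng a\<rbrakk> \<Longrightarrow> x \<in> om a \<longleftrightarrow> a \<in> u (col x)"
begin

text \<open>One-sided inclusion rather than equality of traces: membership may use only the presence
  of indices, as for sets built by unions and intersections without complements.\<close>

definition supported :: "'x set \<Rightarrow> 'a set \<Rightarrow> bool" where
  "supported S B \<longleftrightarrow> (\<forall>a\<in>E. \<forall>b\<in>E. om a \<inter> S \<subseteq> om b \<longrightarrow> a \<in> B \<longrightarrow> b \<in> B)"

lemma supportedD: "\<lbrakk>supported S B; a \<in> E; b \<in> E; om a \<inter> S \<subseteq> om b; a \<in> B\<rbrakk> \<Longrightarrow> b \<in> B"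
  unfolding supported_def by blast

lemma supported_mono: "\<lbrakk>supported S B; S \<subseteq> S'\<rbrakk> \<Longrightarrow> supported S' B"
  unfolding supported_def by blast

definition finitely_supported :: "'a set \<Rightarrow> bool" where
  "finitely_supported B \<longleftrightarrow> (\<exists>S. finite S \<and> S \<subseteq> I \<and> supported S B)"

lemma finitely_supported_Un:
  assumes "finitely_supported B" "finitely_supported B'"
  shows "finitely_supported (B \<union> B')"
proof -
  obtain S S' where S: "finite S" "S \<subseteq> I" "supported S B" "finite S'" "S' \<subseteq> I" "supported S' B'"
    using assms unfolding finitely_supported_def by auto
  have "supported (S \<union> S') B" "supported (S \<union> S') B'"
    using S(3,6) by (auto intro: supported_mono)
  then have "supported (S \<union> S') (B \<union> B')" unfolding supported_def by auto
  moreover have "finite (S \<union> S')" "S \<union> S' \<subseteq> I" using S by auto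
  ultimately show ?thesis unfolding finitely_supported_def by blast
qed

lemma finitely_supported_Int:
  assumes "finitely_supported B" "finitely_supported B'"
  shows "finitely_supported (B \<inter> B')"
proof -
  obtain S S' where S: "finite S" "S \<subseteq> I" "supported S B" "finite S'" "S' \<subseteq> I" "supported S' B'"
    using assms unfolding finitely_supported_def by auto
  have "supported (S \<union> S') B" "supported (S \<union> S') B'"
    using S(3,6) by (auto intro: supported_mono)
  then have "supported (S \<union> S') (B \<inter> B')" unfolding supported_def by auto
  moreover have "finite (S \<union> S')" "S \<union> S' \<subseteq> I" using S by auto
  ultimately show ?thesis unfolding finitely_supported_def by blast
qed

end

section \<open>Limit rows of a crossword\<close>

text \<open>Column supports are fixed by \<open>T\<close> because columns will be evaluated away
  from actual points; for rows, existence of a support is enough.\<close>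

locale crossword = countably_independent E I om rng col u
  for E :: "'a set" and I :: "'x set" and om :: "'a \<Rightarrow> 'x set"
    and rng :: "'a \<Rightarrow> 'x set" and col :: "'x \<Rightarrow> nat" and u :: "nat \<Rightarrow> 'a set" +
  fixes C :: "'a \<Rightarrow> 'a \<Rightarrow> bool" and T :: "'a \<Rightarrow> 'x set"
  assumes rows: "a \<in> E \<Longrightarrow> finitely_supported {b. C a b}"
    and T: "b \<in> E \<Longrightarrow> finite (T b)" "b \<in> E \<Longrightarrow> T b \<subseteq> I" "b \<in> E \<Longrightarrow> supported (T b) {a. C a b}"
begin

lemma column_mono: "\<lbrakk>a \<in> E; a' \<in> E; b \<in> E; om a \<inter> T b \<subseteq> om a'; C a b\<rbrakk> \<Longrightarrow> C a' b"
  using T(3)[of b] by (auto dest: supportedD)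

text \<open>A column depends on finitely many coordinates only, so it can be evaluated at any
  subset \<open>M\<close> of the index set, whether or not \<open>M\<close> comes from a point.\<close>

definition limit_row :: "'x set \<Rightarrow> 'a set" where
  "limit_row M = {b \<in> E. \<exists>a\<in>E. om a \<inter> T b = M \<inter> T b \<and> C a b}"

definition approx :: "'x set \<Rightarrow> 'x set \<Rightarrow> 'a set" where
  "approx M Y = {a \<in> E. om a \<inter> Y = M \<inter> Y}"

lemma approx_antimono: "Y \<subseteq> Y' \<Longrightarrow> approx M Y' \<subseteq> approx M Y"
  unfolding approx_def by blast

lemma approx_nonempty:
  assumes "countable Y" "Y \<subseteq> I" shows "\<exists>a. a \<in> approx M Y"
  using indep[OF assms, of "M \<inter> Y"] unfolding approx_def by auto

text \<open>The choice of witness in \<open>limit_row\<close> is immaterial: the column of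
  \<open>b\<close> cannot distinguish points whose codes agree on \<open>T b\<close>.\<close>

lemma approx_limit_row:
  assumes "a \<in> approx M Y" "b \<in> E" "T b \<subseteq> Y"
  shows "C a b \<longleftrightarrow> b \<in> limit_row M"
proof -
  have a: "a \<in> E" "om a \<inter> T b = M \<inter> T b" using assms by (auto simp: approx_def)
  show ?thesis
  proof
    assume "C a b" then show "b \<in> limit_row M" using a assms(2) by (auto simp: limit_row_def)
  next
    assume "b \<in> limit_row M"
    then obtain a' where "a' \<in> E" "om a' \<inter> T b = M \<inter> T b" "C a' b"
      by (auto simp: limit_row_def)
    then show "C a b" using a assms(2) column_mono[of a' a b] by auto
  qed
qed

text \<open>\<open>R\<close> is a fixed core of the support, and \<open>P\<close> holds the
  \<open>s\<close> further indices used by the row of this particular approximant.\<close>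

definition supported_approx :: "'x set \<Rightarrow> 'x set \<Rightarrow> nat \<Rightarrow> 'x set \<Rightarrow> 'a \<Rightarrow> 'x set \<Rightarrow> bool" where
  "supported_approx M R s Y a P \<longleftrightarrow> a \<in> approx M Y \<and> finite P \<and> P \<subseteq> I \<and> P \<inter> R = {} \<and> card P = s
     \<and> supported (R \<union> P) {b. C a b}"

definition cofinal :: "'x set \<Rightarrow> 'x set \<Rightarrow> nat \<Rightarrow> bool" where
  "cofinal M R s \<longleftrightarrow> (\<forall>Y. countable Y \<longrightarrow> Y \<subseteq> I \<longrightarrow> (\<exists>a P. supported_approx M R s Y a P))"

lemma supported_approx_antimono: "\<lbrakk>supported_approx M R s Y' a P; Y \<subseteq> Y'\<rbrakk> \<Longrightarrow> supported_approx M R s Y a P"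
  using approx_antimono[of Y Y' M] by (auto simp: supported_approx_def)

text \<open>If each \<open>s\<close> failed on some countable \<open>Y s\<close>, a point
  approximating \<open>M\<close> on their union would have a row whose finite support has a size not
  excluded.\<close>

lemma cofinal_exists: "\<exists>s. cofinal M {} s"
proof (rule ccontr)
  assume "\<not> ?thesis"
  then have "\<forall>s. \<exists>Y. countable Y \<and> Y \<subseteq> I \<and> (\<nexists>a P. supported_approx M {} s Y a P)"
    by (auto simp: cofinal_def)
  then obtain Y where Y: "\<And>s. countable (Y s)" "\<And>s. Y s \<subseteq> I"
      "\<And>s a P. \<not> supported_approx M {} s (Y s) a P"
    by metis
  obtain a where a: "a \<in> approx M (\<Union>s. Y s)"
    using approx_nonempty[of "\<Union>s. Y s" M] Y by auto
  then have "a \<in> E" by (simp add: approx_def)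
  then obtain S where S: "finite S" "S \<subseteq> I" "supported S {b. C a b}"
    using rows by (auto simp: finitely_supported_def)
  then have "supported_approx M {} (card S) (\<Union>s. Y s) a S" using a by (simp add: supported_approx_def)
  then have "supported_approx M {} (card S) (Y (card S)) a S" by (rule supported_approx_antimono) auto
  with Y show False by blast
qed

text \<open>Comparing \<open>c\<close> and \<open>d\<close> involves only
  \<open>T c \<union> T d\<close>, so one approximant with a row supported by \<open>R\<close>
  decides both.\<close>

lemma cofinal_zero_limit_row:
  assumes "cofinal M R 0"
  shows "supported R (limit_row M)"
  unfolding supported_def
proof (intro ballI impI)
  fix c d assume cd: "c \<in> E" "d \<in> E" "om c \<inter> R \<subseteq> om d" "c \<in> limit_row M"
  have "countable (T c \<union> T d)" "T c \<union> T d \<subseteq> I"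
    using T cd by (auto simp: countable_finite)
  then obtain a P where g: "supported_approx M R 0 (T c \<union> T d) a P"
    using assms unfolding cofinal_def by blast
  then have a: "a \<in> approx M (T c \<union> T d)" and s: "supported R {b. C a b}"
    by (auto simp: supported_approx_def)
  have "C a c" using approx_limit_row[OF a cd(1)] cd(4) by simp
  then have "C a d" using supportedD[OF s cd(1-3)] by simp
  then show "d \<in> limit_row M" using approx_limit_row[OF a cd(2)] by simp
qed

text \<open>Disjointness allows one \<open>b\<close> to fill or empty the sets \<open>P k\<close>
  independently and so make its column alternate. But \<open>T b\<close> is finite and the codes of
  the \<open>a k\<close> converge on it along a subsequence, so the column must stabilise.\<close>

lemma no_disjoint_supports:
  fixes a :: "nat \<Rightarrow> 'a" and P :: "nat \<Rightarrow> 'x set" and Y :: "nat \<Rightarrow> 'x set"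
  assumes a: "\<And>k. a k \<in> approx M (Y k)"
    and Y: "mono Y" "\<And>k. Y k \<subseteq> I" "\<And>k. rng (a k) \<inter> I \<subseteq> Y (Suc k)"
    and R: "finite R" "R \<subseteq> I"
    and P: "\<And>k. finite (P k)" "\<And>k. P k \<subseteq> I" "\<And>k. P k \<inter> R = {}"
      "\<And>j k. j < k \<Longrightarrow> P j \<inter> P k = {}"
    and sup: "\<And>k. supported (R \<union> P k) {b. C (a k) b}"
    and nsup: "\<And>k. \<not> supported R {b. C (a k) b}"
  shows False
proof -
  have aE: "a k \<in> E" for k using a[of k] by (simp add: approx_def)
  \<comment> \<open>Take \<open>c\<close> in the row and \<open>d\<close> outside it, with the trace
    of \<open>c\<close> on \<open>R\<close> contained in \<open>om d\<close>. Keeping that trace, a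
    full \<open>P k\<close> puts a point above \<open>c\<close> and an empty \<open>P k\<close> puts
    it below \<open>d\<close>.\<close>
  have "\<exists>\<beta>\<subseteq>R. \<forall>b\<in>E. om b \<inter> R = \<beta> \<longrightarrow>
      (P k \<subseteq> om b \<longrightarrow> C (a k) b) \<and> (P k \<inter> om b = {} \<longrightarrow> \<not> C (a k) b)" for k
  proof -
    obtain c d where cd: "c \<in> E" "d \<in> E" "om c \<inter> R \<subseteq> om d" "C (a k) c" "\<not> C (a k) d"
      using nsup[of k] by (auto simp: supported_def)
    have "C (a k) b" if "b \<in> E" "om b \<inter> R = om c \<inter> R" "P k \<subseteq> om b" for b
      using supportedD[OF sup[of k], of c b] that cd by auto
    moreover have "\<not> C (a k) b" if "b \<in> E" "om b \<inter> R = om c \<inter> R" "P k \<inter> om b = {}" for b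
      using supportedD[OF sup[of k], of b d] that cd by auto
    ultimately show ?thesis by (intro exI[of _ "om c \<inter> R"]) auto
  qed
  then obtain \<beta> where \<beta>: "\<And>k. \<beta> k \<subseteq> R"
    and \<beta>1: "\<And>k b. \<lbrakk>b \<in> E; om b \<inter> R = \<beta> k; P k \<subseteq> om b\<rbrakk> \<Longrightarrow> C (a k) b"
    and \<beta>0: "\<And>k b. \<lbrakk>b \<in> E; om b \<inter> R = \<beta> k; P k \<inter> om b = {}\<rbrakk> \<Longrightarrow> \<not> C (a k) b"
    by metis
  \<comment> \<open>Since \<open>R\<close> has finitely many subsets, the traces coincide along a
    subsequence and a single \<open>b\<close> can match them all.\<close>
  have "finite (range \<beta>)"
    by (rule finite_subset[of _ "Pow R"]) (use \<beta> R in auto)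
  then obtain k1 where "infinite {k. \<beta> k = \<beta> k1}"
    using pigeonhole_infinite[of UNIV \<beta>] by auto
  then obtain e :: "nat \<Rightarrow> nat" where e: "strict_mono e" "\<And>k. \<beta> (e k) = \<beta> k1"
    using infinite_enumerate[of "{k. \<beta> k = \<beta> k1}"] by auto
  obtain r :: "nat \<Rightarrow> nat" and L where r: "strict_mono r"
    "\<And>m. \<exists>k0. \<forall>k\<ge>k0. a (e (r k)) \<in> u m \<longleftrightarrow> m \<in> L"
    using pointwise_convergent_subsequence[of UNIV "\<lambda>k. {m. a (e k) \<in> u m}"] by auto
  define f where "f = e \<circ> r"
  have f: "strict_mono f" unfolding f_def using e(1) r(1) by (rule strict_mono_o)
  have f_inj: "f i = f j \<longleftrightarrow> i = j" for i j using f by (simp add: strict_mono_eq)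
  have \<beta>f: "\<beta> (f k) = \<beta> k1" for k by (simp add: f_def e)
  have Pdisj: "P i \<inter> P j = {}" if "i \<noteq> j" for i j
    using P(4)[of i j] P(4)[of j i] that by (cases "i < j") auto
  \<comment> \<open>The pattern for \<open>b\<close>: the common trace on \<open>R\<close>, with the
    even-numbered terms of the chosen subsequence of \<open>P\<close> filled and the odd-numbered
    ones left empty.\<close>
  define Z where "Z = \<beta> k1 \<union> (\<Union>k. P (f (2 * k)))"
  have "\<exists>b\<in>E. om b \<inter> (R \<union> (\<Union>k. P k)) = Z"
  proof (rule indep)
    show "countable (R \<union> (\<Union>k. P k))" using R P by (simp add: countable_finite)
    show "R \<union> (\<Union>k. P k) \<subseteq> I" using R P by auto
    show "Z \<subseteq> R \<union> (\<Union>k. P k)" using \<beta> by (auto simp: Z_def)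
  qed
  then obtain b where b: "b \<in> E" "om b \<inter> (R \<union> (\<Union>k. P k)) = Z" by blast
  have "om b \<inter> R = Z \<inter> R" using b(2) by blast
  also have "\<dots> = \<beta> k1" unfolding Z_def using \<beta>[of k1] P(3) by blast
  finally have bR: "om b \<inter> R = \<beta> (f k)" for k by (simp add: \<beta>f)
  have even: "C (a (f (2 * k))) b" for k
  proof (rule \<beta>1[OF b(1) bR])
    show "P (f (2 * k)) \<subseteq> om b" using b(2) by (auto simp: Z_def)
  qed
  have odd: "\<not> C (a (f (2 * k + 1))) b" for k
  proof (rule \<beta>0[OF b(1) bR])
    have "P (f (2 * k + 1)) \<inter> P (f (2 * j)) = {}" for j
    proof (rule Pdisj)
      have "2 * k + 1 \<noteq> 2 * j" by presburger
      then show "f (2 * k + 1) \<noteq> f (2 * j)" using f_inj by blast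
    qed
    moreover have "P (f (2 * k + 1)) \<inter> \<beta> k1 = {}" using \<beta>[of k1] P(3) by blast
    ultimately have "P (f (2 * k + 1)) \<inter> Z = {}" by (auto simp: Z_def)
    then show "P (f (2 * k + 1)) \<inter> om b = {}" using b(2) by blast
  qed
  \<comment> \<open>The limit code: it is \<open>M\<close> on the sets \<open>Y k\<close>. An index
    of \<open>I\<close> outside all of them lies in no \<open>rng (a k)\<close>, so its membership
    is read off from \<open>u\<close> and converges to \<open>L\<close>.\<close>
  define \<Lambda> where "\<Lambda> = {x. if x \<in> (\<Union>k. Y k) then x \<in> M else col x \<in> L}"
  have "\<exists>k0. \<forall>k\<ge>k0. x \<in> om (a (f k)) \<longleftrightarrow> x \<in> \<Lambda>" if x: "x \<in> T b" for x
  proof (cases "x \<in> (\<Union>k. Y k)")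
    case True
    then obtain k0 where "x \<in> Y k0" by blast
    have "x \<in> om (a (f k)) \<longleftrightarrow> x \<in> \<Lambda>" if "k \<ge> k0" for k
    proof -
      have "k0 \<le> f k" using that seq_suble[OF f, of k] by simp
      then have "x \<in> Y (f k)" using \<open>x \<in> Y k0\<close> Y(1) by (auto dest: monoD)
      then have "x \<in> om (a (f k)) \<longleftrightarrow> x \<in> M" using a[of "f k"] by (auto simp: approx_def)
      then show ?thesis using True by (simp add: \<Lambda>_def)
    qed
    then show ?thesis by blast
  next
    case False
    have "x \<in> I" using x T(2)[OF b(1)] by blast
    then have "x \<notin> rng (a k)" for k using Y(3)[of k] False by blast
    then have "x \<in> om (a k) \<longleftrightarrow> a k \<in> u (col x)" for k using generic[OF aE \<open>x \<in> I\<close>] by simp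
    moreover have "x \<in> \<Lambda> \<longleftrightarrow> col x \<in> L" using False by (simp add: \<Lambda>_def)
    ultimately show ?thesis using r(2)[of "col x"] by (simp add: f_def)
  qed
  then obtain k0 where k0: "\<And>k. k \<ge> k0 \<Longrightarrow> om (a (f k)) \<inter> T b = \<Lambda> \<inter> T b"
    using eventually_inter_finite_eq[OF T(1)[OF b(1)], of "\<lambda>k. om (a (f k))" \<Lambda>] by blast
  have "om (a (f (2 * k0))) \<inter> T b = om (a (f (2 * k0 + 1))) \<inter> T b"
    using k0[of "2 * k0"] k0[of "2 * k0 + 1"] by simp
  then have "om (a (f (2 * k0))) \<inter> T b \<subseteq> om (a (f (2 * k0 + 1)))" by blast
  from column_mono[OF aE aE b(1) this even] odd show False by blast
qed

text \<open>Choose \<open>R\<close> so that the number \<open>s\<close> of extra indices is least.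
  If \<open>s\<close> were positive, minimality would keep indices from recurring in the extra
  supports, giving the disjoint supports just excluded.\<close>

lemma limit_row_finitely_supported: "finitely_supported (limit_row M)"
proof -
  define s where "s = (LEAST s. \<exists>R. finite R \<and> R \<subseteq> I \<and> cofinal M R s)"
  have "\<exists>s R. finite R \<and> R \<subseteq> I \<and> cofinal M R s"
    using cofinal_exists[of M] by blast
  then have "\<exists>R. finite R \<and> R \<subseteq> I \<and> cofinal M R s"
    unfolding s_def by (rule LeastI_ex)
  then obtain R where R: "finite R" "R \<subseteq> I" "cofinal M R s" by blast
  have least: "\<not> cofinal M R' s'" if "s' < s" "finite R'" "R' \<subseteq> I" for R' s'
    using not_less_Least[of s' "\<lambda>s. \<exists>R. finite R \<and> R \<subseteq> I \<and> cofinal M R s"] that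
    unfolding s_def by blast
  show ?thesis
  proof (cases "s = 0")
    case True
    then show ?thesis
      using R cofinal_zero_limit_row unfolding finitely_supported_def by blast
  next
    case False
    \<comment> \<open>Minimality is used twice: \<open>Y0\<close> excludes rows supported by
      \<open>R\<close> alone, and \<open>D x\<close> excludes extra supports containing
      \<open>x\<close>, since moving \<open>x\<close> into \<open>R\<close> would leave only
      \<open>s - 1\<close> extra indices.\<close>
    obtain Y0 where Y0: "countable Y0" "Y0 \<subseteq> I" "\<And>a P. \<not> supported_approx M R 0 Y0 a P"
      using least[of 0 R] False R(1,2) unfolding cofinal_def by auto
    have "\<exists>Y. countable Y \<and> Y \<subseteq> I \<and> (\<forall>a P. \<not> supported_approx M (insert x R) (s - 1) Y a P)"
      if "x \<in> I" for x
      using least[of "s - 1" "insert x R"] False R(1,2) that unfolding cofinal_def by auto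
    then obtain D where D: "\<And>x. x \<in> I \<Longrightarrow> countable (D x)" "\<And>x. x \<in> I \<Longrightarrow> D x \<subseteq> I"
        "\<And>x a P. x \<in> I \<Longrightarrow> \<not> supported_approx M (insert x R) (s - 1) (D x) a P"
      by metis
    have "\<forall>Y. \<exists>a P. countable Y \<longrightarrow> Y \<subseteq> I \<longrightarrow> supported_approx M R s Y a P"
      using R(3) unfolding cofinal_def by blast
    then obtain a P where aP: "\<And>Y. \<lbrakk>countable Y; Y \<subseteq> I\<rbrakk> \<Longrightarrow> supported_approx M R s Y (a Y) (P Y)"
      by metis
    \<comment> \<open>Adding the range prepares the convergence argument; adding the sets
      \<open>D x\<close> makes all later supports avoid the indices of the present one.\<close>
    define next_set where
      "next_set Y = Y \<union> (rng (a Y) \<inter> I) \<union> (\<Union>x\<in>P Y. D x)" for Y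
    define Y where "Y k = (next_set ^^ k) Y0" for k
    have Y_Suc: "Y (Suc k) = next_set (Y k)" for k by (simp add: Y_def)
    have Y: "countable (Y k) \<and> Y k \<subseteq> I" for k
    proof (induction k)
      case 0 show ?case using Y0 by (simp add: Y_def)
    next
      case (Suc k)
      then have g: "supported_approx M R s (Y k) (a (Y k)) (P (Y k))" using aP by blast
      then have "a (Y k) \<in> E" "finite (P (Y k))" "P (Y k) \<subseteq> I"
        by (auto simp: supported_approx_def approx_def)
      then have "countable (rng (a (Y k)) \<inter> I)" "countable (\<Union>x\<in>P (Y k). D x)"
        "(\<Union>x\<in>P (Y k). D x) \<subseteq> I"
        using countable_rng D(1,2) by (blast intro: countable_UN countable_finite countable_Int1)+
      with Suc show ?case by (simp add: Y_Suc next_set_def)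
    qed
    have g: "supported_approx M R s (Y k) (a (Y k)) (P (Y k))" for k using aP Y by blast
    have mono: "mono Y"
      by (rule incseq_SucI) (auto simp: Y_Suc next_set_def)
    have "Y 0 \<subseteq> Y k" for k using mono by (simp add: monoD)
    then have Y0sub: "Y0 \<subseteq> Y k" for k by (simp add: Y_def)
    have False
    proof (rule no_disjoint_supports[where a = "\<lambda>k. a (Y k)" and P = "\<lambda>k. P (Y k)" and Y = Y
          and R = R and M = M])
      show "a (Y k) \<in> approx M (Y k)" "finite (P (Y k))" "P (Y k) \<subseteq> I" "P (Y k) \<inter> R = {}"
        "supported (R \<union> P (Y k)) {b. C (a (Y k)) b}" for k
        using g[of k] by (auto simp: supported_approx_def)
      show "rng (a (Y k)) \<inter> I \<subseteq> Y (Suc k)" for k by (auto simp: Y_Suc next_set_def)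
      show "\<not> supported R {b. C (a (Y k)) b}" for k
      proof
        assume "supported R {b. C (a (Y k)) b}"
        then have "supported_approx M R 0 (Y k) (a (Y k)) {}" using g[of k] by (simp add: supported_approx_def)
        then show False using supported_approx_antimono[OF _ Y0sub] Y0(3) by blast
      qed
      show "P (Y j) \<inter> P (Y k) = {}" if "j < k" for j k
      proof (rule ccontr)
        assume "P (Y j) \<inter> P (Y k) \<noteq> {}"
        then obtain x where x: "x \<in> P (Y j)" "x \<in> P (Y k)" by blast
        then have xI: "x \<in> I" using g[of j] by (auto simp: supported_approx_def)
        have "D x \<subseteq> Y (Suc j)" using x by (auto simp: Y_Suc next_set_def)
        also have "\<dots> \<subseteq> Y k" using that mono by (simp add: monoD)
        finally have "D x \<subseteq> Y k" .
        have "insert x R \<union> (P (Y k) - {x}) = R \<union> P (Y k)" using x by blast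
        then have "supported_approx M (insert x R) (s - 1) (Y k) (a (Y k)) (P (Y k) - {x})"
          using g[of k] x by (auto simp: supported_approx_def)
        then show False using supported_approx_antimono[OF _ \<open>D x \<subseteq> Y k\<close>] D(3)[OF xI] by blast
      qed
    qed (use Y mono R in auto)
    then show ?thesis ..
  qed
qed

section \<open>Joint finite support of a crossword\<close>

text \<open>For finite \<open>M\<close> and \<open>N\<close> these are basic open boxes inside
  \<open>C\<close> and, for \<open>refutes\<close>, inside its complement: certificates that
  \<open>C\<close> is open and closed.\<close>

definition forces :: "'x set \<Rightarrow> 'x set \<Rightarrow> bool" where
  "forces M N \<longleftrightarrow> (\<forall>a\<in>E. \<forall>b\<in>E. M \<subseteq> om a \<longrightarrow> N \<subseteq> om b \<longrightarrow> C a b)"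

definition refutes :: "'x set \<Rightarrow> 'x set \<Rightarrow> bool" where
  "refutes M N \<longleftrightarrow> (\<forall>a\<in>E. \<forall>b\<in>E. M \<inter> om a = {} \<longrightarrow> N \<inter> om b = {} \<longrightarrow> \<not> C a b)"

lemma limit_row_forces:
  assumes "a \<in> E" "b \<in> E" "b \<in> limit_row M" "M \<subseteq> om a"
  shows "C a b"
proof -
  obtain a' where "a' \<in> E" "om a' \<inter> T b = M \<inter> T b" "C a' b"
    using assms by (auto simp: limit_row_def)
  then show ?thesis using column_mono[of a' a b] assms by blast
qed

text \<open>Only \<open>om a \<inter> I\<close> is compared with \<open>M\<close>, since codes may
  leave \<open>I\<close> whereas column supports do not.\<close>

lemma limit_row_refutes:
  assumes "a \<in> E" "b \<in> E" "b \<notin> limit_row M" "om a \<inter> I \<subseteq> M"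
  shows "\<not> C a b"
proof
  assume "C a b"
  obtain a' where a': "a' \<in> approx M (T b)"
    using approx_nonempty[of "T b" M] T[OF assms(2)] by (auto simp: countable_finite)
  then have "om a \<inter> T b \<subseteq> om a'" using assms(4) T(2)[OF assms(2)] by (auto simp: approx_def)
  then have "C a' b" using column_mono[of a a' b] assms a' \<open>C a b\<close> by (auto simp: approx_def)
  then show False using approx_limit_row[OF a'] assms by blast
qed

text \<open>Cutting the code of \<open>a\<close> down to the finite set
  \<open>M = om a \<inter> T b\<close> keeps \<open>b\<close> in the limit row. A finite support of
  that row provides \<open>N\<close>, and monotonicity of columns extends the conclusion to all
  points above \<open>M\<close>.\<close>

lemma forces_exists:
  assumes "a \<in> E" "b \<in> E" "C a b"
  shows "\<exists>M N. finite M \<and> finite N \<and> M \<subseteq> om a \<inter> I \<and> N \<subseteq> om b \<inter> I \<and> forces M N"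
proof -
  define M where "M = om a \<inter> T b"
  have b: "b \<in> limit_row M" using assms by (auto simp: limit_row_def M_def)
  obtain S where S: "finite S" "S \<subseteq> I" "supported S (limit_row M)"
    using limit_row_finitely_supported unfolding finitely_supported_def by blast
  have "forces M (om b \<inter> S)"
    unfolding forces_def
  proof (intro ballI impI)
    fix a1 b1 assume *: "a1 \<in> E" "b1 \<in> E" "M \<subseteq> om a1" "om b \<inter> S \<subseteq> om b1"
    then have "b1 \<in> limit_row M" using supportedD[OF S(3) assms(2)] b by blast
    then show "C a1 b1" using limit_row_forces * by blast
  qed
  moreover have "finite M" "M \<subseteq> om a \<inter> I" using T[OF assms(2)] by (auto simp: M_def)
  ultimately show ?thesis using S by (intro exI[of _ M] exI[of _ "om b \<inter> S"]) auto
qed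

text \<open>Order-dual argument, with the limit row taken at \<open>I - M\<close>, the largest
  subset of \<open>I\<close> that omits the finitely many indices of \<open>T b\<close> missing from
  \<open>om a\<close>.\<close>

lemma refutes_exists:
  assumes "a \<in> E" "b \<in> E" "\<not> C a b"
  shows "\<exists>M N. finite M \<and> finite N \<and> M \<subseteq> I - om a \<and> N \<subseteq> I - om b \<and> refutes M N"
proof -
  define M where "M = T b - om a"
  have "a \<in> approx (I - M) (T b)" using assms T(2)[of b] by (auto simp: approx_def M_def)
  then have b: "b \<notin> limit_row (I - M)" using assms approx_limit_row by blast
  obtain S where S: "finite S" "S \<subseteq> I" "supported S (limit_row (I - M))"
    using limit_row_finitely_supported unfolding finitely_supported_def by blast
  have "refutes M (S - om b)"
    unfolding refutes_def
  proof (intro ballI impI)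
    fix a1 b1 assume *: "a1 \<in> E" "b1 \<in> E" "M \<inter> om a1 = {}" "(S - om b) \<inter> om b1 = {}"
    then have "b1 \<notin> limit_row (I - M)" using supportedD[OF S(3) *(2) assms(2)] b by blast
    then show "\<not> C a1 b1" using limit_row_refutes[of a1 b1 "I - M"] * by blast
  qed
  moreover have "finite M" "M \<subseteq> I - om a" using T[OF assms(2)] by (auto simp: M_def)
  ultimately show ?thesis using S by (intro exI[of _ M] exI[of _ "S - om b"]) auto
qed

text \<open>Otherwise independence yields codes that contain \<open>M\<close> and \<open>N\<close>
  but avoid \<open>M'\<close> and \<open>N'\<close>, hence a pair both inside and outside
  \<open>C\<close>.\<close>

lemma forces_refutes_meet:
  assumes "forces M N" "refutes M' N'" "finite M" "finite N" "finite M'" "finite N'"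
    "M \<subseteq> I" "N \<subseteq> I" "M' \<subseteq> I" "N' \<subseteq> I"
  shows "M \<inter> M' \<noteq> {} \<or> N \<inter> N' \<noteq> {}"
proof (rule ccontr)
  assume *: "\<not> ?thesis"
  obtain a where a: "a \<in> E" "om a \<inter> (M \<union> M') = M"
    using indep[of "M \<union> M'" M] assms(3,5,7,9) by (auto simp: countable_finite)
  obtain b where b: "b \<in> E" "om b \<inter> (N \<union> N') = N"
    using indep[of "N \<union> N'" N] assms(4,6,8,10) by (auto simp: countable_finite)
  have "C a b" using assms(1) a b unfolding forces_def by blast
  moreover have "\<not> C a b" using assms(2) a b * unfolding refutes_def by blast
  ultimately show False by blast
qed

text \<open>Compactness: if every finite \<open>F\<close> failed, certificates for a sequence of
  failures would lie in a countable \<open>Y\<close>, on which the failing pairs have a limit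
  \<open>(p, q)\<close>. A finite certificate at the limit contradicts a late failure.\<close>

lemma jointly_finitely_supported:
  "\<exists>F. finite F \<and> F \<subseteq> I \<and> (\<forall>a\<in>E. \<forall>b\<in>E. \<forall>a'\<in>E. \<forall>b'\<in>E.
     om a \<inter> F \<subseteq> om a' \<longrightarrow> om b \<inter> F \<subseteq> om b' \<longrightarrow> C a b \<longrightarrow> C a' b')"
proof (rule ccontr)
  assume neg: "\<not> ?thesis"
  define bad where "bad F a b a' b' M N M' N' \<longleftrightarrow>
      a \<in> E \<and> b \<in> E \<and> a' \<in> E \<and> b' \<in> E \<and> om a \<inter> F \<subseteq> om a' \<and> om b \<inter> F \<subseteq> om b' \<and>
      finite M \<and> finite N \<and> M \<subseteq> om a \<inter> I \<and> N \<subseteq> om b \<inter> I \<and> forces M N \<and>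
      finite M' \<and> finite N' \<and> M' \<subseteq> I - om a' \<and> N' \<subseteq> I - om b' \<and> refutes M' N'"
    for F a b a' b' M N M' N'
  have "\<exists>a b a' b' M N M' N'. bad F a b a' b' M N M' N'" if F: "finite F \<and> F \<subseteq> I" for F
  proof -
    obtain a b a' b' where ab: "a \<in> E" "b \<in> E" "a' \<in> E" "b' \<in> E"
      "om a \<inter> F \<subseteq> om a'" "om b \<inter> F \<subseteq> om b'" "C a b" "\<not> C a' b'"
      using neg[unfolded not_ex, THEN spec, of F] F by auto
    obtain M N where 1: "finite M" "finite N" "M \<subseteq> om a \<inter> I" "N \<subseteq> om b \<inter> I" "forces M N"
      using forces_exists[OF ab(1,2,7)] by blast
    obtain M' N' where 2: "finite M'" "finite N'" "M' \<subseteq> I - om a'" "N' \<subseteq> I - om b'" "refutes M' N'"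
      using refutes_exists[OF ab(3,4,8)] by blast
    have "bad F a b a' b' M N M' N'"
      unfolding bad_def using ab(1-6) 1 2 by (intro conjI)
    then show ?thesis by blast
  qed
  then obtain a b a' b' M N M' N' where
    "\<And>F. finite F \<and> F \<subseteq> I \<Longrightarrow> bad F (a F) (b F) (a' F) (b' F) (M F) (N F) (M' F) (N' F)"
    by metis
  note * = this[OF conjI, unfolded bad_def]
  \<comment> \<open>Each stage absorbs the four certificate sets of the previous one, so all of them
    lie in the union \<open>Y\<close>.\<close>
  define F where "F k = ((\<lambda>F. F \<union> M F \<union> N F \<union> M' F \<union> N' F) ^^ k) {}" for k
  have F_Suc: "F (Suc k) = F k \<union> M (F k) \<union> N (F k) \<union> M' (F k) \<union> N' (F k)" for k
    by (simp add: F_def)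
  have F: "finite (F k) \<and> F k \<subseteq> I" for k
  proof (induction k)
    case (Suc k) then show ?case using *[of "F k"] by (auto simp: F_Suc)
  qed (simp add: F_def)
  define Y where "Y = (\<Union>k. F k)"
  have Y: "countable Y" "Y \<subseteq> I" using F by (auto simp: Y_def countable_finite)
  have mono: "mono F" by (rule incseq_SucI) (auto simp: F_Suc)
  have in_Y: "M (F k) \<subseteq> Y" "N (F k) \<subseteq> Y" "M' (F k) \<subseteq> Y" "N' (F k) \<subseteq> Y" for k
    unfolding Y_def using F_Suc[of k] by blast+
  obtain r :: "nat \<Rightarrow> nat" and \<alpha> where r: "strict_mono r"
    "\<And>y. y \<in> Y \<Longrightarrow> \<exists>k0. \<forall>k\<ge>k0. y \<in> om (a (F (r k))) \<longleftrightarrow> y \<in> \<alpha>"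
    using pointwise_convergent_subsequence[OF Y(1), of "\<lambda>k. om (a (F k))"] by blast
  obtain t :: "nat \<Rightarrow> nat" and \<beta> where t: "strict_mono t"
    "\<And>y. y \<in> Y \<Longrightarrow> \<exists>k0. \<forall>k\<ge>k0. y \<in> om (b (F (r (t k)))) \<longleftrightarrow> y \<in> \<beta>"
    using pointwise_convergent_subsequence[OF Y(1), of "\<lambda>k. om (b (F (r k)))"] by blast
  define G where "G k = F (r (t k))" for k
  have G: "finite (G k)" "G k \<subseteq> I" for k using F by (auto simp: G_def)
  have \<alpha>: "\<exists>k0. \<forall>k\<ge>k0. y \<in> om (a (G k)) \<longleftrightarrow> y \<in> \<alpha>" if "y \<in> Y" for y
    using r(2)[OF that] seq_suble[OF t(1)] unfolding G_def by (meson order_trans)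
  have \<beta>: "\<exists>k0. \<forall>k\<ge>k0. y \<in> om (b (G k)) \<longleftrightarrow> y \<in> \<beta>" if "y \<in> Y" for y
    using t(2)[OF that] unfolding G_def .
  \<comment> \<open>Phrased as convergence to \<open>UNIV\<close> so that the result on finite
    traces also yields inclusion in \<open>G k\<close>.\<close>
  have inG: "\<exists>k0. \<forall>k\<ge>k0. y \<in> G k \<longleftrightarrow> y \<in> UNIV" if "y \<in> Y" for y
  proof -
    obtain k0 where k0: "y \<in> F k0" using \<open>y \<in> Y\<close> by (auto simp: Y_def)
    have "y \<in> G k" if "k \<ge> k0" for k
    proof -
      have "k0 \<le> r (t k)" using that seq_suble[OF t(1), of k] seq_suble[OF r(1), of "t k"] by simp
      then show ?thesis using monoD[OF mono] k0 by (auto simp: G_def)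
    qed
    then show ?thesis by blast
  qed
  obtain p where p: "p \<in> E" "om p \<inter> Y = \<alpha> \<inter> Y" using indep[OF Y, of "\<alpha> \<inter> Y"] by auto
  obtain q where q: "q \<in> E" "om q \<inter> Y = \<beta> \<inter> Y" using indep[OF Y, of "\<beta> \<inter> Y"] by auto
  have stable: "\<exists>k. om (a (G k)) \<inter> (U \<inter> Y) = om p \<inter> (U \<inter> Y) \<and>
      om (b (G k)) \<inter> (V \<inter> Y) = om q \<inter> (V \<inter> Y) \<and> (U \<union> V) \<inter> Y \<subseteq> G k"
    if fin: "finite U" "finite V" for U V
  proof -
    obtain k0 where k0: "\<forall>k\<ge>k0. om (a (G k)) \<inter> (U \<inter> Y) = \<alpha> \<inter> (U \<inter> Y)"
      using eventually_inter_finite_eq[of "U \<inter> Y" "\<lambda>k. om (a (G k))" \<alpha>, OF _ \<alpha>] fin by auto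
    obtain k1 where k1: "\<forall>k\<ge>k1. om (b (G k)) \<inter> (V \<inter> Y) = \<beta> \<inter> (V \<inter> Y)"
      using eventually_inter_finite_eq[of "V \<inter> Y" "\<lambda>k. om (b (G k))" \<beta>, OF _ \<beta>] fin by auto
    obtain k2 where k2: "\<forall>k\<ge>k2. G k \<inter> ((U \<union> V) \<inter> Y) = UNIV \<inter> ((U \<union> V) \<inter> Y)"
      using eventually_inter_finite_eq[of "(U \<union> V) \<inter> Y" G UNIV, OF _ inG] fin by auto
    define k where "k = max k0 (max k1 k2)"
    have "om (a (G k)) \<inter> (U \<inter> Y) = \<alpha> \<inter> (U \<inter> Y)" using k0 by (simp add: k_def)
    moreover have "om (b (G k)) \<inter> (V \<inter> Y) = \<beta> \<inter> (V \<inter> Y)" using k1 by (simp add: k_def)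
    moreover have "G k \<inter> ((U \<union> V) \<inter> Y) = UNIV \<inter> ((U \<union> V) \<inter> Y)" using k2 by (simp add: k_def)
    ultimately show ?thesis using p(2) q(2) by (intro exI[of _ k]) blast
  qed
  show False
  proof (cases "C p q")
    case True
    then obtain U V where UV: "finite U" "finite V" "U \<subseteq> om p \<inter> I" "V \<subseteq> om q \<inter> I" "forces U V"
      using forces_exists[OF p(1) q(1) True] by blast
    obtain k where k: "om (a (G k)) \<inter> (U \<inter> Y) = om p \<inter> (U \<inter> Y)"
        "om (b (G k)) \<inter> (V \<inter> Y) = om q \<inter> (V \<inter> Y)" "(U \<union> V) \<inter> Y \<subseteq> G k"
      using stable[OF UV(1,2)] by blast
    note Gk = *[OF G(1,2)[of k]]
    have Y': "M' (G k) \<subseteq> Y" "N' (G k) \<subseteq> Y" using in_Y by (simp_all add: G_def)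
    have "U \<inter> M' (G k) \<noteq> {} \<or> V \<inter> N' (G k) \<noteq> {}"
      using forces_refutes_meet[of U V "M' (G k)" "N' (G k)"] UV Gk by blast
    \<comment> \<open>Within \<open>Y\<close> the forcing sets lie in \<open>G k\<close> and in the
      codes of the unprimed pair, hence pass to the primed pair, whose codes avoid
      \<open>M' (G k)\<close> and \<open>N' (G k)\<close>.\<close>
    moreover have "U \<inter> Y \<subseteq> om (a' (G k))" "V \<inter> Y \<subseteq> om (b' (G k))"
      using k UV(3,4) Gk by blast+
    ultimately show False using Gk Y' by blast
  next
    case False
    then obtain U V where UV: "finite U" "finite V" "U \<subseteq> I - om p" "V \<subseteq> I - om q" "refutes U V"
      using refutes_exists[OF p(1) q(1) False] by blast
    obtain k where k: "om (a (G k)) \<inter> (U \<inter> Y) = om p \<inter> (U \<inter> Y)"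
        "om (b (G k)) \<inter> (V \<inter> Y) = om q \<inter> (V \<inter> Y)"
      using stable[OF UV(1,2)] by blast
    note Gk = *[OF G(1,2)[of k]]
    have Y': "M (G k) \<subseteq> Y" "N (G k) \<subseteq> Y" using in_Y by (simp_all add: G_def)
    have "M (G k) \<inter> U \<noteq> {} \<or> N (G k) \<inter> V \<noteq> {}"
      using forces_refutes_meet[of "M (G k)" "N (G k)" U V] UV Gk by blast
    \<comment> \<open>Within \<open>Y\<close> the refuting sets avoid the codes of the unprimed
      pair, which contain \<open>M (G k)\<close> and \<open>N (G k)\<close>.\<close>
    then show False using Gk Y' k UV(3,4) by blast
  qed
qed

lemma diagonal_finitely_supported: "finitely_supported {b \<in> E. C b b}"
proof -
  obtain F where "finite F" "F \<subseteq> I" "\<forall>a\<in>E. \<forall>b\<in>E. \<forall>a'\<in>E. \<forall>b'\<in>E.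
     om a \<inter> F \<subseteq> om a' \<longrightarrow> om b \<inter> F \<subseteq> om b' \<longrightarrow> C a b \<longrightarrow> C a' b'"
    using jointly_finitely_supported by blast
  then have "supported F {b \<in> E. C b b}" unfolding supported_def by blast
  then show ?thesis using \<open>finite F\<close> \<open>F \<subseteq> I\<close> unfolding finitely_supported_def by blast
qed

end

context countably_independent
begin

lemma crossword_diagonal:
  assumes "C \<subseteq> E \<times> E"
    and rows: "\<And>a. a \<in> E \<Longrightarrow> finitely_supported {b. (a, b) \<in> C}"
    and cols: "\<And>b. b \<in> E \<Longrightarrow> finitely_supported {a. (a, b) \<in> C}"
  shows "finitely_supported {b. (b, b) \<in> C}"
proof -
  obtain T where T: "\<And>b. b \<in> E \<Longrightarrow> finite (T b) \<and> T b \<subseteq> I \<and> supported (T b) {a. (a, b) \<in> C}"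
    using cols unfolding finitely_supported_def by metis
  interpret crossword E I om rng col u "\<lambda>a b. (a, b) \<in> C" T
    by unfold_locales (use T rows in auto)
  have "{b \<in> E. (b, b) \<in> C} = {b. (b, b) \<in> C}" using assms(1) by blast
  then show ?thesis using diagonal_finitely_supported by simp
qed

end

section \<open>The first uncountable ordinal\<close>

unbundle cardinal_syntax

lemma card_of_omega1: "|omega1| =o cardSuc natLeq"
  unfolding omega1_def by (rule card_of_Field_ordIso) (simp add: cardSuc_Card_order natLeq_Card_order)

lemma uncountable_omega1: "uncountable omega1"
proof
  assume "countable omega1"
  then obtain f :: "nat set \<Rightarrow> nat" where "inj_on f omega1" by (auto simp: countable_def)
  then have "|omega1| \<le>o |UNIV :: nat set|" using card_of_ordLeq by blast
  then have "cardSuc natLeq \<le>o natLeq"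
    using card_of_omega1 card_of_nat ordIso_ordLeq_trans ordIso_symmetric ordLeq_ordIso_trans by blast
  then show False
    using cardSuc_greater[OF natLeq_Card_order] not_ordLess_ordLeq by blast
qed

lemma omega1_nonempty: "omega1 \<noteq> {}"
  using uncountable_omega1 by auto

lemma omega1_avoid:
  assumes "countable Y" shows "\<exists>\<gamma>\<in>omega1. (n, \<gamma>) \<notin> Y"
proof (rule ccontr)
  assume "\<not> ?thesis"
  then have "omega1 \<subseteq> snd ` Y" by force
  then show False using uncountable_omega1 assms countable_subset[OF _ countable_image] by metis
qed

section \<open>The concrete codes of points\<close>

definition indices :: "(nat \<times> nat set) set" where
  "indices = UNIV \<times> omega1"

text \<open>This instantiates \<open>om\<close>. It is not restricted to \<open>indices\<close>; the
  supports carry that restriction.\<close>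

definition code :: "(nat \<Rightarrow> ((nat \<Rightarrow> nat \<times> nat set) \<times> nat set) set)
    \<Rightarrow> (nat \<Rightarrow> nat \<times> nat set) \<times> nat set \<Rightarrow> (nat \<times> nat set) set" where
  "code u a = {(n, \<gamma>). a \<in> w u n \<gamma>}"

lemma mem_code [simp]: "(n, \<gamma>) \<in> code u a \<longleftrightarrow> a \<in> w u n \<gamma>"
  by (simp add: code_def)

text \<open>An injection can enumerate all of \<open>Y\<close>, and at indices in its range
  \<open>w\<close> reads the second component, which is arbitrary.\<close>

lemma code_independent:
  assumes "countable Y" "Y \<subseteq> indices" "Z \<subseteq> Y"
  shows "\<exists>a\<in>A. code u a \<inter> Y = Z"
proof -
  obtain \<gamma>0 where \<gamma>0: "\<gamma>0 \<in> omega1" using omega1_nonempty by blast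
  \<comment> \<open>The padding makes the set infinite, so that \<open>from_nat_into\<close> is a
    bijection from the naturals and hence injective.\<close>
  define Y' where "Y' = Y \<union> range (\<lambda>n::nat. (n, \<gamma>0))"
  have "infinite (range (\<lambda>n::nat. (n, \<gamma>0)))" by (rule range_inj_infinite) (simp add: inj_on_def)
  then have "infinite Y'" by (simp add: Y'_def)
  moreover have "countable Y'" using assms(1) by (simp add: Y'_def)
  ultimately have f: "bij_betw (from_nat_into Y') UNIV Y'" (is "bij_betw ?f _ _")
    by (simp add: bij_betw_from_nat_into)
  define a where "a = (?f, {i. ?f i \<in> Z})"
  have inj: "inj ?f" and ran: "range ?f = Y'" using f by (auto simp: bij_betw_def)
  have "Y' \<subseteq> indices" using assms(2) \<gamma>0 by (auto simp: Y'_def indices_def)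
  then have aA: "a \<in> A" using inj ran by (simp add: a_def A_def A'_def A''_def indices_def)
  have "(n, \<gamma>) \<in> code u a \<longleftrightarrow> (n, \<gamma>) \<in> Z" if "(n, \<gamma>) \<in> Y" for n \<gamma>
  proof -
    have "(n, \<gamma>) \<in> range ?f" using that ran by (simp add: Y'_def)
    then have "a \<in> w u n \<gamma> \<longleftrightarrow> (\<exists>i. ?f i = (n, \<gamma>) \<and> ?f i \<in> Z)"
      using aA by (simp add: w_def a_def)
    also have "\<dots> \<longleftrightarrow> (n, \<gamma>) \<in> Z" using \<open>(n, \<gamma>) \<in> range ?f\<close> by auto
    finally show ?thesis by simp
  qed
  then have "code u a \<inter> Y = Z" using assms(3) by auto
  then show ?thesis using aA by blast
qed

lemma w_generic: "\<lbrakk>a \<in> A; (n, \<gamma>) \<notin> range (fst a)\<rbrakk> \<Longrightarrow> a \<in> w u n \<gamma> \<longleftrightarrow> a \<in> u n"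
  by (cases a) (simp add: w_def)

lemma w_subset: "w u n \<gamma> \<subseteq> A"
  by (auto simp: w_def)

interpretation indep: countably_independent A indices "code u" "\<lambda>a. range (fst a)" fst u for u
proof
  show "\<exists>a\<in>A. code u a \<inter> Y = Z" if "countable Y" "Y \<subseteq> indices" "Z \<subseteq> Y" for Y Z
    using code_independent[OF that] .
qed (auto simp: w_generic)

section \<open>Members of \<open>W\<close> as finitely supported sets\<close>

lemma W_closed:
  shows W_un: "S \<in> W u \<Longrightarrow> S' \<in> W u \<Longrightarrow> S \<union> S' \<in> W u"
    and W_int: "S \<in> W u \<Longrightarrow> S' \<in> W u \<Longrightarrow> S \<inter> S' \<in> W u"
    and W_empty: "{} \<in> W u" and W_top: "A \<in> W u"
    and W_gen: "\<gamma> \<in> omega1 \<Longrightarrow> w u n \<gamma> \<in> W u"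
  unfolding W_def by (auto intro: union_inter_closure.intros)

lemma W_finitely_supported:
  assumes "B \<in> W u" shows "B \<subseteq> A \<and> indep.finitely_supported u B"
  using assms unfolding W_def
proof induction
  case (base B)
  then consider "B = {}" | "B = A" | n \<gamma> where "B = w u n \<gamma>" "\<gamma> \<in> omega1" by blast
  then show ?case
  proof cases
    case 3
    then have "indep.supported u {(n, \<gamma>)} B" "{(n, \<gamma>)} \<subseteq> indices"
      by (auto simp: indep.supported_def indices_def)
    then show ?thesis using 3 w_subset unfolding indep.finitely_supported_def by blast
  qed (auto simp: indep.finitely_supported_def indep.supported_def intro: exI[of _ "{}"])
next
  case (un B B')
  then show ?case using indep.finitely_supported_Un by blast
next
  case (int B B')
  then show ?case using indep.finitely_supported_Int by blast
qed

text \<open>Monotone disjunctive normal form: \<open>B\<close> is the union of one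
  \<open>box\<close> for each trace of its points on \<open>S\<close>. There are finitely many
  traces, and each box is a finite intersection of generators with \<open>A\<close>.\<close>

lemma finitely_supported_W:
  assumes "B \<subseteq> A" "indep.finitely_supported u B" shows "B \<in> W u"
proof -
  obtain S where S: "finite S" "S \<subseteq> indices" "indep.supported u S B"
    using assms(2) unfolding indep.finitely_supported_def by blast
  define box where "box F = {b \<in> A. F \<subseteq> code u b}" for F
  have box: "box F \<in> W u" if "finite F" "F \<subseteq> indices" for F
    using that
  proof (induction F)
    case empty
    have "box {} = A" by (auto simp: box_def)
    then show ?case using W_top by simp
  next
    case (insert x F)
    obtain n \<gamma> where x: "x = (n, \<gamma>)" "\<gamma> \<in> omega1" using insert.prems by (auto simp: indices_def)
    have "box (insert x F) = box F \<inter> w u n \<gamma>" using x w_subset by (auto simp: box_def)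
    then show ?case using insert W_int W_gen[OF x(2)] by auto
  qed
  have union: "\<Union>\<G> \<in> W u" if "finite \<G>" "\<G> \<subseteq> W u" for \<G>
    using that by (induction \<G>) (auto intro: W_un W_empty)
  have "B = \<Union>(box ` ((\<lambda>a. code u a \<inter> S) ` B))"
  proof (intro equalityI subsetI)
    fix b assume "b \<in> B" then show "b \<in> \<Union>(box ` ((\<lambda>a. code u a \<inter> S) ` B))"
      using assms(1) by (auto simp: box_def)
  next
    fix b assume "b \<in> \<Union>(box ` ((\<lambda>a. code u a \<inter> S) ` B))"
    then obtain a where "a \<in> B" "b \<in> A" "code u a \<inter> S \<subseteq> code u b" by (auto simp: box_def)
    then show "b \<in> B" using indep.supportedD[OF S(3)] assms(1) by blast
  qed
  also have "\<dots> \<in> W u"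
  proof (rule union)
    have "finite ((\<lambda>a. code u a \<inter> S) ` B)"
      by (rule finite_subset[of _ "Pow S"]) (use S in auto)
    then show "finite (box ` ((\<lambda>a. code u a \<inter> S) ` B))" by simp
    show "box ` ((\<lambda>a. code u a \<inter> S) ` B) \<subseteq> W u"
      using box S by (auto intro!: box finite_Int)
  qed
  finally show ?thesis .
qed

section \<open>Comonoid property, non-discreteness and separation\<close>

lemma pratt_comonoid_W: "pratt_comonoid A (W u)"
  unfolding pratt_comonoid_def
proof (intro conjI allI impI)
  show "W u \<subseteq> Pow A" using W_finitely_supported by blast
  fix C :: "(((nat \<Rightarrow> nat \<times> nat set) \<times> nat set) \<times> ((nat \<Rightarrow> nat \<times> nat set) \<times> nat set)) set"
  assume C: "C \<subseteq> A \<times> A" "\<forall>a\<in>A. {b. (a, b) \<in> C} \<in> W u \<and> {b. (b, a) \<in> C} \<in> W u"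
  have "indep.finitely_supported u {b. (b, b) \<in> C}"
    using indep.crossword_diagonal[OF C(1)] C(2) W_finitely_supported by blast
  then show "{b. (b, b) \<in> C} \<in> W u" using C(1) by (intro finitely_supported_W) auto
qed (rule W_empty W_top)+

text \<open>The complement of a generator depends antitonically on the code, so it has no finite
  support in the monotone sense.\<close>

lemma not_discrete_W: "\<not> discrete A (W u)"
proof
  assume "discrete A (W u)"
  obtain \<gamma> where \<gamma>: "\<gamma> \<in> omega1" using omega1_nonempty by blast
  have A_W: "A - w u 0 \<gamma> \<in> W u" using \<open>discrete A (W u)\<close> by (simp add: discrete_def)
  obtain S where S: "finite S" "S \<subseteq> indices" "indep.supported u S (A - w u 0 \<gamma>)"
    using W_finitely_supported[OF A_W] unfolding indep.finitely_supported_def by blast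
  have x: "(0, \<gamma>) \<in> indices" using \<gamma> by (simp add: indices_def)
  obtain a where a: "a \<in> A" "code u a \<inter> {(0, \<gamma>)} = {}"
    using code_independent[of "{(0, \<gamma>)}" "{}" u] x by auto
  \<comment> \<open>Containing all of \<open>S\<close> places \<open>b\<close> above
    \<open>a\<close> on the support, although \<open>b\<close> lies in the generator.\<close>
  obtain b where b: "b \<in> A" "code u b \<inter> insert (0, \<gamma>) S = insert (0, \<gamma>) S"
    using code_independent[of "insert (0, \<gamma>) S" "insert (0, \<gamma>) S" u] x S by (auto simp: countable_finite)
  have "b \<in> A - w u 0 \<gamma>"
    using indep.supportedD[OF S(3) a(1) b(1)] a b by auto
  moreover have "(0, \<gamma>) \<in> code u b" using b(2) by blast
  ultimately show False by simp
qed

text \<open>For \<open>\<gamma>\<close> such that \<open>(n, \<gamma>)\<close> avoids both countable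
  ranges, the generator agrees with \<open>u n\<close> at \<open>a\<close> and at
  \<open>b\<close>.\<close>

lemma T1_W:
  assumes "T1_family A (range u)" shows "T1_family A (W u)"
  unfolding T1_family_def
proof (intro ballI impI)
  fix a b assume ab: "a \<in> A" "b \<in> A" "a \<noteq> b"
  then obtain n where n: "a \<in> u n" "b \<notin> u n" using assms unfolding T1_family_def by blast
  obtain \<gamma> where \<gamma>: "\<gamma> \<in> omega1" "(n, \<gamma>) \<notin> range (fst a) \<union> range (fst b)"
    using omega1_avoid[of "range (fst a) \<union> range (fst b)" n] by auto
  then have "a \<in> w u n \<gamma>" "b \<notin> w u n \<gamma>" using n ab w_generic by auto
  then show "\<exists>S\<in>W u. a \<in> S \<and> b \<notin> S" using W_gen \<gamma>(1) by blast
qed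

section \<open>Cardinalities of \<open>A\<close> and \<open>W\<close>\<close>

lemma card_of_A: "|A| =o |UNIV :: nat set set|"
proof -
  \<comment> \<open>Elements of \<open>omega1\<close> are themselves sets of naturals here. The tags
    0, 1 and 2 keep apart the second component of \<open>a\<close>, the numbers
    \<open>fst (fst a i)\<close> and the sets \<open>snd (fst a i)\<close>.\<close>
  define h :: "(nat \<Rightarrow> nat \<times> nat set) \<times> nat set \<Rightarrow> nat set" where
    "h a = (\<lambda>k. prod_encode (0, k)) ` snd a
       \<union> (\<lambda>i. prod_encode (1, prod_encode (i, fst (fst a i)))) ` UNIV
       \<union> (\<lambda>(i, k). prod_encode (2, prod_encode (i, k))) ` (SIGMA i:UNIV. snd (fst a i))" for a
  have 0: "k \<in> snd a \<longleftrightarrow> prod_encode (0, k) \<in> h a" for a k by (auto simp: h_def)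
  have 1: "m = fst (fst a i) \<longleftrightarrow> prod_encode (1, prod_encode (i, m)) \<in> h a" for a i m
    by (auto simp: h_def)
  have 2: "k \<in> snd (fst a i) \<longleftrightarrow> prod_encode (2, prod_encode (i, k)) \<in> h a" for a i k
    by (auto simp: h_def image_iff)
  have "inj h"
  proof (rule injI)
    fix a b assume eq: "h a = h b"
    have "snd a = snd b" using eq 0 by blast
    moreover have "fst a i = fst b i" for i
      by (rule prod_eqI) (use eq 1[of _ a i] 1[of _ b i] 2[of _ a i] 2[of _ b i] in auto)
    ultimately show "a = b" by (intro prod_eqI ext) auto
  qed
  then have "inj_on h A" by (rule inj_on_subset) simp
  then have le: "|A| \<le>o |UNIV :: nat set set|" using card_of_ordLeq by blast
  obtain \<gamma> where \<gamma>: "\<gamma> \<in> omega1" using omega1_nonempty by blast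
  \<comment> \<open>For the lower bound one injection is fixed and only the second component
    varies.\<close>
  define g :: "nat set \<Rightarrow> (nat \<Rightarrow> nat \<times> nat set) \<times> nat set" where "g s = (\<lambda>n. (n, \<gamma>), s)" for s
  have "inj g" "range g \<subseteq> A" using \<gamma> by (auto simp: g_def A_def A'_def A''_def inj_on_def)
  then have "|UNIV :: nat set set| \<le>o |A|" using card_of_ordLeq by blast
  with le show ?thesis by (simp add: ordIso_iff_ordLeq)
qed

text \<open>Countably many stages \<open>H k\<close> exhaust the closure, and an infinite cardinal
  bound survives squares, finite unions and countable unions.\<close>

lemma card_of_union_inter_closure:
  fixes G :: "'a set set"
  assumes "infinite (Field r)" "Card_order r" "|G| \<le>o r"
  shows "|union_inter_closure G| \<le>o r"
proof -
  define step where "step H = H \<union> (\<lambda>(S, T). S \<union> T) ` (H \<times> H) \<union> (\<lambda>(S, T). S \<inter> T) ` (H \<times> H)"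
    for H :: "'a set set"
  define H where "H k = (step ^^ k) G" for k
  have H_Suc: "H (Suc k) = step (H k)" for k by (simp add: H_def)
  have card: "|H k| \<le>o r" for k
  proof (induction k)
    case 0 then show ?case using assms by (simp add: H_def)
  next
    case (Suc k)
    have "|H k \<times> H k| \<le>o r"
      using card_of_Times_ordLeq_infinite_Field[OF assms(1) Suc Suc assms(2)] .
    then have "|f ` (H k \<times> H k)| \<le>o r" for f :: "'a set \<times> 'a set \<Rightarrow> 'a set"
      using card_of_image ordLeq_transitive by blast
    then show ?case
      unfolding H_Suc step_def
      using Suc by (intro card_of_Un_ordLeq_infinite_Field[OF assms(1) _ _ assms(2)])
  qed
  have "mono H" by (rule incseq_SucI) (auto simp: H_Suc step_def)
  have "union_inter_closure G \<subseteq> (\<Union>k. H k)"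
  proof
    fix S assume "S \<in> union_inter_closure G"
    then show "S \<in> (\<Union>k. H k)"
    proof induction
      case (base S) then have "S \<in> H 0" by (simp add: H_def)
      then show ?case by blast
    next
      case (un S T)
      then obtain i j where "S \<in> H i" "T \<in> H j" by blast
      then have "S \<in> H (max i j)" "T \<in> H (max i j)"
        using monoD[OF \<open>mono H\<close>, of i "max i j"] monoD[OF \<open>mono H\<close>, of j "max i j"] by auto
      then have "S \<union> T \<in> H (Suc (max i j))" by (auto simp: H_Suc step_def)
      then show ?case by blast
    next
      case (int S T)
      then obtain i j where "S \<in> H i" "T \<in> H j" by blast
      then have "S \<in> H (max i j)" "T \<in> H (max i j)"
        using monoD[OF \<open>mono H\<close>, of i "max i j"] monoD[OF \<open>mono H\<close>, of j "max i j"] by auto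
      then have "S \<inter> T \<in> H (Suc (max i j))" by (auto simp: H_Suc step_def)
      then show ?case by blast
    qed
  qed
  then have "|union_inter_closure G| \<le>o |\<Union>k. H k|" by (rule card_of_mono1)
  moreover have "|UNIV :: nat set| \<le>o r"
    using assms(1,2) infinite_iff_card_of_nat card_of_Field_ordIso ordLeq_ordIso_trans by blast
  then have "|\<Union>k. H k| \<le>o r"
    using card_of_UNION_ordLeq_infinite_Field[OF assms(1,2)] card by blast
  ultimately show ?thesis by (rule ordLeq_transitive)
qed

text \<open>The upper bound counts generators. For the lower bound, independence provides a point in
  \<open>w u 0 \<gamma>\<close> outside \<open>w u 0 \<delta>\<close> whenever
  \<open>\<gamma>\<close> and \<open>\<delta>\<close> are distinct elements of
  \<open>omega1\<close>.\<close>

lemma card_of_W: "|W u| =o cardSuc natLeq"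
proof -
  let ?r = "cardSuc natLeq"
  have r: "Card_order ?r" by (simp add: cardSuc_Card_order natLeq_Card_order)
  have inf: "infinite (Field ?r)" using uncountable_omega1 by (auto simp: omega1_def countable_finite)
  have le: "|omega1| \<le>o ?r" using card_of_omega1 ordIso_iff_ordLeq by blast
  have nat: "|UNIV :: nat set| \<le>o ?r"
    using card_of_nat cardSuc_ordLeq[OF natLeq_Card_order] ordIso_ordLeq_trans by blast
  have eq: "{w u n \<gamma> | n \<gamma>. \<gamma> \<in> omega1} = (\<lambda>(n, \<gamma>). w u n \<gamma>) ` (UNIV \<times> omega1)" by auto
  have "|UNIV \<times> omega1 :: (nat \<times> nat set) set| \<le>o ?r"
    using card_of_Times_ordLeq_infinite_Field[OF inf nat le r] .
  then have gen: "|{w u n \<gamma> | n \<gamma>. \<gamma> \<in> omega1}| \<le>o ?r"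
    unfolding eq by (rule ordLeq_transitive[OF card_of_image])
  have "countable {{}, A}" by simp
  then obtain f :: "_ \<Rightarrow> nat" where "inj_on f {{}, A}" by (rule countableE)
  then have "|{{}, A}| \<le>o |UNIV :: nat set|" by (rule card_of_ordLeqI) simp
  then have "|{{}, A}| \<le>o ?r" using nat by (rule ordLeq_transitive)
  with gen have "|{w u n \<gamma> | n \<gamma>. \<gamma> \<in> omega1} \<union> {{}, A}| \<le>o ?r"
    using card_of_Un_ordLeq_infinite_Field[OF inf _ _ r] by blast
  then have upper: "|W u| \<le>o ?r"
    unfolding W_def by (rule card_of_union_inter_closure[OF inf r])
  have "inj_on (w u 0) omega1"
  proof (rule inj_onI, rule ccontr)
    fix \<gamma> \<delta> assume *: "\<gamma> \<in> omega1" "\<delta> \<in> omega1" "w u 0 \<gamma> = w u 0 \<delta>" "\<gamma> \<noteq> \<delta>"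
    have "\<exists>a\<in>A. code u a \<inter> {(0, \<gamma>), (0, \<delta>)} = {(0, \<gamma>)}"
      by (rule code_independent) (use * in \<open>auto simp: indices_def\<close>)
    then obtain a where "code u a \<inter> {(0, \<gamma>), (0, \<delta>)} = {(0, \<gamma>)}" by blast
    then have "x \<in> code u a \<inter> {(0, \<gamma>), (0, \<delta>)} \<longleftrightarrow> x = (0, \<gamma>)" for x by simp
    from this[of "(0, \<gamma>)"] this[of "(0, \<delta>)"] show False using *(3,4) by simp
  qed
  moreover have "w u 0 ` omega1 \<subseteq> W u" using W_gen by auto
  ultimately have "|omega1| \<le>o |W u|" using card_of_ordLeq by blast
  then have "?r \<le>o |W u|" using card_of_omega1 ordIso_ordLeq_trans ordIso_symmetric by blast
  with upper show ?thesis by (simp add: ordIso_iff_ordLeq)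
qed

theorem theorem6p19:
  fixes u :: "nat \<Rightarrow> ((nat \<Rightarrow> nat \<times> nat set) \<times> nat set) set"
  assumes "\<And>n. u n \<subseteq> A"
    and "T1_family A (range u)"
  shows "pratt_comonoid A (W u) \<and> \<not> discrete A (W u) \<and> T1_family A (W u)
         \<and> (card_of A, card_of (UNIV :: nat set set)) \<in> ordIso
         \<and> (card_of (W u), cardSuc natLeq) \<in> ordIso"
  using pratt_comonoid_W not_discrete_W T1_W[OF assms(2)] card_of_A card_of_W by blast

end
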